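(* Assume $\operatorname{char} k=0$. Let $H(z)\in k\langle\langle z\rangle\rangle^{\times n}$ and $N_t(z)\in k[[t]]\langle\langle z\rangle\rangle^{\times n}$ with $o(H(z))\ge 2$ and $o(N_t(z))\ge 2$. The following statements are equivalent: (1) The formal map $G_t(z)=z+tN_t(z)$ is the inverse of $F_t(z)=z-tH(z)$. (2) $N_t(z)\in k[[t]]\langle\langle z\rangle\rangle^{\times n}$ is the unique power series solution of the Cauchy problem $$\frac{\partial N_t}{\partial t}=\left[N_t\frac{\partial}{\partial z}\right]N_t,\qquad N_{t=0}(z)=H(z).$$
   Context: $k$ is a (commutative) unital integral domain; $n\ge 1$; $z=(z_1,\dots,z_n)$ are noncommutative free variables; $t$ is a formal parameter commuting with $z$. $k\langle\langle z\rangle\rangle$ and $k[[t]]\langle\langle z\rangle\rangle$ are the algebras of formal power series in the noncommuting variables $z_i$ over $k$ and $k[[t]]$. The order $o(U)$ of a vector $U$ is the minimum of the orders (lowest degree in $z$; $t$ counts as a scalar) of its components. "$G_t$ is the inverse of $F_t$" means $F_t(G_t(z))=z=G_t(F_t(z))$, where $u(F_t)$ denotes substitution of the components of $F_t$ for the $z_i$ (componentwise for vectors). For a vector $\vec u=(u_1,\dots,u_n)$ over $k[[t]]\langle\langle z\rangle\rangle$, $[\vec u\frac{\partial}{\partial z}]$ denotes the unique $k[[t]]$-derivation of $k[[t]]\langle\langle z\rangle\rangle$ sending $z_i$ to $u_i$ for all $i$; applied to a vector it acts componentwise. $\frac{\partial}{\partial t}$ acts coefficientwise, with $\frac{\partial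 z_i}{\partial t}=0$. *)

theory Defs
  imports
    "HOL-Analysis.Finite_Cartesian_Product"
    "HOL-Computational_Algebra.Formal_Power_Series"
    "HOL-Library.Extended_Nat"
begin

section \<open>Formal power series in noncommuting variables\<close>

text \<open>
  A series over the coefficient ring \<open>'r\<close> in free variables indexed by \<open>'n\<close> is the family of its
  coefficients, indexed by the words over \<open>'n\<close>. The commutative coefficients commute with the
  variables.
\<close>

typedef ('r, 'n) ncfps = "UNIV :: ('n list \<Rightarrow> 'r) set"
  morphisms nc_nth Abs_ncfps ..

lemma nc_nth_Abs [simp]: "nc_nth (Abs_ncfps f) = f"
  by (simp add: Abs_ncfps_inverse)

lemma nc_eqI: "(\<And>w. nc_nth U w = nc_nth V w) \<Longrightarrow> U = V"
  by (metis ext nc_nth_inject)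

instantiation ncfps :: (comm_ring_1, type) ring_1
begin

definition zero_ncfps :: "('a, 'b) ncfps" where
  "0 = Abs_ncfps (\<lambda>w. 0)"

definition one_ncfps :: "('a, 'b) ncfps" where
  "1 = Abs_ncfps (\<lambda>w. if w = [] then 1 else 0)"

definition plus_ncfps :: "('a, 'b) ncfps \<Rightarrow> ('a, 'b) ncfps \<Rightarrow> ('a, 'b) ncfps" where
  "U + V = Abs_ncfps (\<lambda>w. nc_nth U w + nc_nth V w)"

definition minus_ncfps :: "('a, 'b) ncfps \<Rightarrow> ('a, 'b) ncfps \<Rightarrow> ('a, 'b) ncfps" where
  "U - V = Abs_ncfps (\<lambda>w. nc_nth U w - nc_nth V w)"

definition uminus_ncfps :: "('a, 'b) ncfps \<Rightarrow> ('a, 'b) ncfps" where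
  "- U = Abs_ncfps (\<lambda>w. - nc_nth U w)"

definition times_ncfps :: "('a, 'b) ncfps \<Rightarrow> ('a, 'b) ncfps \<Rightarrow> ('a, 'b) ncfps" where
  "U * V = Abs_ncfps (\<lambda>w. \<Sum>i=0..length w. nc_nth U (take i w) * nc_nth V (drop i w))"

instance
proof
  fix a b c :: "('a, 'b) ncfps"
  show "a * b * c = a * (b * c)"
  proof (rule nc_eqI)
    fix w :: "'b list"
    let ?n = "length w"
    let ?f = "\<lambda>i j k. nc_nth a (take i w) * nc_nth b (take j (drop i w)) * nc_nth c (drop (i + j) w)"
    have "nc_nth (a * b * c) w = (\<Sum>j=0..?n. \<Sum>i=0..j. ?f i (j - i) (?n - j))"
      by (auto simp: times_ncfps_def sum_distrib_right min_def drop_take intro!: sum.cong split: if_splits)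
    also have "\<dots> = (\<Sum>j=0..?n. \<Sum>i=0..?n - j. ?f j i (?n - j - i))"
      by (rule fps_mult_assoc_lemma)
    also have "\<dots> = nc_nth (a * (b * c)) w"
      by (auto simp: times_ncfps_def sum_distrib_left mult.assoc add.commute intro!: sum.cong)
    finally show "nc_nth (a * b * c) w = nc_nth (a * (b * c)) w" .
  qed
  show "1 * a = a"
  proof (rule nc_eqI)
    fix w :: "'b list"
    have "nc_nth (1 * a) w = (\<Sum>i=0..length w. if i = 0 then nc_nth a w else 0)"
      unfolding times_ncfps_def one_ncfps_def nc_nth_Abs by (rule sum.cong) auto
    thus "nc_nth (1 * a) w = nc_nth a w" by simp
  qed
  show "a * 1 = a"
  proof (rule nc_eqI)
    fix w :: "'b list"
    have "nc_nth (a * 1) w = (\<Sum>i=0..length w. if i = length w then nc_nth a w else 0)"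
      unfolding times_ncfps_def one_ncfps_def nc_nth_Abs by (rule sum.cong) auto
    thus "nc_nth (a * 1) w = nc_nth a w" by simp
  qed
  show "(0::('a, 'b) ncfps) \<noteq> 1"
  proof
    assume "(0::('a, 'b) ncfps) = 1"
    hence "nc_nth (0::('a, 'b) ncfps) [] = nc_nth 1 []" by simp
    thus False by (simp add: zero_ncfps_def one_ncfps_def)
  qed
qed (simp_all add: zero_ncfps_def plus_ncfps_def minus_ncfps_def uminus_ncfps_def times_ncfps_def
      algebra_simps sum.distrib nc_nth_inverse)

end

lemma nc_nth_zero [simp]: "nc_nth 0 w = 0"
  by (simp add: zero_ncfps_def)

lemma nc_nth_one: "nc_nth 1 w = (if w = [] then 1 else 0)"
  by (simp add: one_ncfps_def)

lemma nc_nth_add [simp]: "nc_nth (U + V) w = nc_nth U w + nc_nth V w"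
  by (simp add: plus_ncfps_def)

lemma nc_nth_diff [simp]: "nc_nth (U - V) w = nc_nth U w - nc_nth V w"
  by (simp add: minus_ncfps_def)

lemma nc_nth_uminus [simp]: "nc_nth (- U) w = - nc_nth U w"
  by (simp add: uminus_ncfps_def)

lemma nc_nth_mult:
  "nc_nth (U * V) w = (\<Sum>i=0..length w. nc_nth U (take i w) * nc_nth V (drop i w))"
  by (simp add: times_ncfps_def)

lemma nc_nth_sum: "nc_nth (\<Sum>i\<in>A. f i) w = (\<Sum>i\<in>A. nc_nth (f i) w)"
  by (induction A rule: infinite_finite_induct) auto

definition nc_scale :: "'r::comm_ring_1 \<Rightarrow> ('r, 'n) ncfps \<Rightarrow> ('r, 'n) ncfps" where
  "nc_scale c U = Abs_ncfps (\<lambda>w. c * nc_nth U w)"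

definition nc_var :: "'n \<Rightarrow> ('r::comm_ring_1, 'n) ncfps" where
  "nc_var i = Abs_ncfps (\<lambda>w. if w = [i] then 1 else 0)"

definition nc_vars :: "('r::comm_ring_1, 'n::finite) ncfps ^ 'n" where
  "nc_vars = (\<chi> i. nc_var i)"

definition nc_map :: "('r \<Rightarrow> 's) \<Rightarrow> ('r, 'n) ncfps \<Rightarrow> ('s, 'n) ncfps" where
  "nc_map f U = Abs_ncfps (\<lambda>w. f (nc_nth U w))"

text \<open>The zero series has order \<open>\<infinity>\<close>.\<close>

definition nc_order :: "('r::zero, 'n) ncfps \<Rightarrow> enat" where
  "nc_order U = (INF w\<in>{w. nc_nth U w \<noteq> 0}. enat (length w))"

definition nc_vec_order :: "('r::zero, 'n) ncfps ^ 'n::finite \<Rightarrow> enat" where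
  "nc_vec_order U = (INF i. nc_order (U $ i))"

text \<open>
  \<open>nc_subst u F\<close> is the series \<open>u(F)\<close>, the sum of \<open>nc_nth u v\<close> times the product of the
  \<open>F $ i\<close> along \<open>v\<close> over all words \<open>v\<close>, for \<open>F\<close> without constant terms. As in
  \<^const>\<open>fps_compose\<close>, the sum defining the coefficient of \<open>w\<close> is truncated to words \<open>v\<close> that are
  not longer than \<open>w\<close>, because the other words contribute \<open>0\<close>.
\<close>

definition nc_subst ::
    "('r::comm_ring_1, 'n::finite) ncfps \<Rightarrow> ('r, 'n) ncfps ^ 'n \<Rightarrow> ('r, 'n) ncfps" where
  "nc_subst u F = Abs_ncfps (\<lambda>w. \<Sum>v | length v \<le> length w.
     nc_nth u v * nc_nth (prod_list (map (\<lambda>i. F $ i) v)) w)"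

definition nc_vec_subst ::
    "('r::comm_ring_1, 'n::finite) ncfps ^ 'n \<Rightarrow> ('r, 'n) ncfps ^ 'n \<Rightarrow> ('r, 'n) ncfps ^ 'n" where
  "nc_vec_subst u F = (\<chi> i. nc_subst (u $ i) F)"

definition nc_inverse_map ::
    "('r::comm_ring_1, 'n::finite) ncfps ^ 'n \<Rightarrow> ('r, 'n) ncfps ^ 'n \<Rightarrow> bool" where
  "nc_inverse_map G F \<longleftrightarrow> nc_vec_subst F G = nc_vars \<and> nc_vec_subst G F = nc_vars"


section \<open>Derivations\<close>

definition nc_derivation ::
    "(('r::comm_ring_1, 'n) ncfps \<Rightarrow> ('r, 'n) ncfps) \<Rightarrow> bool" where
  "nc_derivation D \<longleftrightarrow>
     (\<forall>U V. D (U + V) = D U + D V) \<and>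
     (\<forall>c U. D (nc_scale c U) = nc_scale c (D U)) \<and>
     (\<forall>U V. D (U * V) = D U * V + U * D V)"

text \<open>\<open>nc_deriv u\<close> is \<open>[u \<partial>/\<partial>z]\<close>; see \<open>nc_deriv_unique_existence\<close> below.\<close>

definition nc_deriv ::
    "('r::comm_ring_1, 'n::finite) ncfps ^ 'n \<Rightarrow> ('r, 'n) ncfps \<Rightarrow> ('r, 'n) ncfps" where
  "nc_deriv u = (THE D. nc_derivation D \<and> (\<forall>i. D (nc_var i) = u $ i))"

definition nc_vec_deriv ::
    "('r::comm_ring_1, 'n::finite) ncfps ^ 'n \<Rightarrow> ('r, 'n) ncfps ^ 'n \<Rightarrow> ('r, 'n) ncfps ^ 'n" where
  "nc_vec_deriv u V = (\<chi> i. nc_deriv u (V $ i))"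

lemma nc_nth_scale [simp]: "nc_nth (nc_scale c U) w = c * nc_nth U w"
  by (simp add: nc_scale_def)

lemma nc_nth_var: "nc_nth (nc_var i) w = (if w = [i] then 1 else 0)"
  by (simp add: nc_var_def)

lemma nc_scale_mult_left: "nc_scale c U * V = nc_scale c (U * V)"
  by (rule nc_eqI) (simp add: nc_nth_mult sum_distrib_left mult.assoc)

lemma nc_scale_mult_right: "U * nc_scale c V = nc_scale c (U * V)"
  by (rule nc_eqI) (simp add: nc_nth_mult sum_distrib_left mult.left_commute)

definition nc_shift :: "'n \<Rightarrow> ('r, 'n) ncfps \<Rightarrow> ('r, 'n) ncfps" where
  "nc_shift x U = Abs_ncfps (\<lambda>w. nc_nth U (x # w))"

lemma nc_nth_shift [simp]: "nc_nth (nc_shift x U) w = nc_nth U (x # w)"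
  by (simp add: nc_shift_def)

lemma nc_nth_mult_Nil [simp]: "nc_nth (U * V) [] = nc_nth U [] * nc_nth V []"
  by (simp add: nc_nth_mult)

lemma nc_nth_mult_Cons:
  "nc_nth (U * V) (x # w) = nc_nth U [] * nc_nth V (x # w) + nc_nth (nc_shift x U * V) w"
  by (simp add: nc_nth_mult sum.atLeast0_atMost_Suc_shift del: sum.cl_ivl_Suc)

lemma nc_shift_add: "nc_shift x (U + V) = nc_shift x U + nc_shift x V"
  by (rule nc_eqI) simp

lemma nc_shift_scale: "nc_shift x (nc_scale c U) = nc_scale c (nc_shift x U)"
  by (rule nc_eqI) simp

lemma nc_shift_mult:
  "nc_shift x (U * V) = nc_scale (nc_nth U []) (nc_shift x V) + nc_shift x U * V"
  by (rule nc_eqI) (simp add: nc_nth_mult_Cons)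

lemma nc_shift_var: "nc_shift x (nc_var i) = (if x = i then 1 else 0)"
  by (rule nc_eqI) (auto simp: nc_nth_var nc_nth_one)

lemma nc_nth_var_mult_Cons:
  "nc_nth (nc_var i * U) (y # w) = (if y = i then nc_nth U w else 0)"
  by (simp add: nc_nth_mult_Cons nc_nth_var nc_shift_var)

lemma nc_decompose:
  "(U :: ('r::comm_ring_1, 'n::finite) ncfps) =
     nc_scale (nc_nth U []) 1 + (\<Sum>x\<in>UNIV. nc_var x * nc_shift x U)"
proof (rule nc_eqI)
  fix w show "nc_nth U w =
      nc_nth (nc_scale (nc_nth U []) 1 + (\<Sum>x\<in>UNIV. nc_var x * nc_shift x U)) w"
    by (cases w) (simp_all add: nc_nth_one nc_nth_sum nc_nth_var_mult_Cons nc_nth_var)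
qed

primrec nc_deriv_coeff ::
    "('r::comm_ring_1, 'n::finite) ncfps ^ 'n \<Rightarrow> 'n list \<Rightarrow> ('r, 'n) ncfps \<Rightarrow> 'r" where
  "nc_deriv_coeff u [] U = nc_nth (\<Sum>x\<in>UNIV. (u $ x) * nc_shift x U) []"
| "nc_deriv_coeff u (y # w) U =
     nc_nth (\<Sum>x\<in>UNIV. (u $ x) * nc_shift x U) (y # w) + nc_deriv_coeff u w (nc_shift y U)"

lemma nc_deriv_coeff_add:
  "nc_deriv_coeff u w (U + V) = nc_deriv_coeff u w U + nc_deriv_coeff u w V"
  by (induction w arbitrary: U V)
     (simp_all add: nc_shift_add distrib_left sum.distrib del: nc_nth_mult_Nil)

lemma nc_deriv_coeff_scale:
  "nc_deriv_coeff u w (nc_scale c U) = c * nc_deriv_coeff u w U"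
  by (induction w arbitrary: U)
     (simp_all add: nc_shift_scale nc_scale_mult_right nc_nth_sum sum_distrib_left distrib_left
       mult.left_commute)

lemma nc_deriv_coeff_mult:
  "nc_deriv_coeff u w (U * V) =
     nc_nth (Abs_ncfps (\<lambda>w. nc_deriv_coeff u w U) * V) w +
     nc_nth (U * Abs_ncfps (\<lambda>w. nc_deriv_coeff u w V)) w"
proof (induction w arbitrary: U V)
  case Nil
  show ?case
    by (simp add: nc_shift_mult nc_nth_sum sum.distrib sum_distrib_left sum_distrib_right
        algebra_simps)
next
  case (Cons y w)
  let ?D = "\<lambda>U. Abs_ncfps (\<lambda>w. nc_deriv_coeff u w U)"
  let ?S = "\<lambda>U. \<Sum>x\<in>UNIV. (u $ x) * nc_shift x U"
  have S: "?S (U * V) = nc_scale (nc_nth U []) (?S V) + ?S U * V"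
    by (rule nc_eqI)
       (simp add: nc_shift_mult distrib_left sum.distrib nc_scale_mult_right nc_nth_sum
         sum_distrib_left sum_distrib_right mult.assoc)
  have sh: "nc_shift y (?D U) = nc_shift y (?S U) + ?D (nc_shift y U)"
    by (rule nc_eqI) simp
  have nil: "nc_nth (?D U) [] = nc_nth (?S U) []"
    by simp
  have "nc_deriv_coeff u (y # w) (U * V) =
      nc_nth (?S (U * V)) (y # w) + nc_deriv_coeff u w (nc_shift y (U * V))"
    by simp
  also have "nc_deriv_coeff u w (nc_shift y (U * V)) =
      nc_nth U [] * nc_deriv_coeff u w (nc_shift y V) +
      (nc_nth (?D (nc_shift y U) * V) w + nc_nth (nc_shift y U * ?D V) w)"
    by (simp only: nc_shift_mult nc_deriv_coeff_add nc_deriv_coeff_scale Cons.IH)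
  also have "nc_nth (?S (U * V)) (y # w) =
      nc_nth U [] * nc_nth (?S V) (y # w) + nc_nth (?S U * V) (y # w)"
    by (simp only: S nc_nth_add nc_nth_scale)
  also have "nc_nth (?S U * V) (y # w) =
      nc_nth (?S U) [] * nc_nth V (y # w) + nc_nth (nc_shift y (?S U) * V) w"
    by (rule nc_nth_mult_Cons)
  finally have 1: "nc_deriv_coeff u (y # w) (U * V) =
      nc_nth U [] * nc_nth (?S V) (y # w) +
      (nc_nth (?S U) [] * nc_nth V (y # w) + nc_nth (nc_shift y (?S U) * V) w) +
      (nc_nth U [] * nc_deriv_coeff u w (nc_shift y V) +
      (nc_nth (?D (nc_shift y U) * V) w + nc_nth (nc_shift y U * ?D V) w))" .
  have 2: "nc_nth (?D U * V) (y # w) =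
      nc_nth (?S U) [] * nc_nth V (y # w) +
      (nc_nth (nc_shift y (?S U) * V) w + nc_nth (?D (nc_shift y U) * V) w)"
    by (simp only: nc_nth_mult_Cons sh nil distrib_right nc_nth_add)
  have 3: "nc_nth (U * ?D V) (y # w) =
      nc_nth U [] * (nc_nth (?S V) (y # w) + nc_deriv_coeff u w (nc_shift y V)) +
      nc_nth (nc_shift y U * ?D V) w"
    by (simp only: nc_nth_mult_Cons nc_nth_Abs nc_deriv_coeff.simps)
  show ?case
    unfolding 1 2 3 by (simp only: distrib_left ac_simps)
qed

lemma nc_deriv_coeff_one: "nc_deriv_coeff u w 1 = 0"
  using nc_deriv_coeff_mult[of u w 1 1] by simp

lemma nc_deriv_coeff_zero: "nc_deriv_coeff u w 0 = 0"
  using nc_deriv_coeff_scale[of u w 0 0] nc_deriv_coeff_add[of u w 0 0] by simp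

lemma nc_deriv_coeff_var: "nc_deriv_coeff u w (nc_var i) = nc_nth (u $ i) w"
proof -
  have "(u $ x) * nc_shift x (nc_var i) = (if x = i then u $ i else 0)" for x
    by (simp add: nc_shift_var)
  hence S: "(\<Sum>x\<in>UNIV. (u $ x) * nc_shift x (nc_var i)) = u $ i"
    by simp
  show ?thesis
    by (cases w; simp only: nc_deriv_coeff.simps S)
       (simp add: nc_shift_var nc_deriv_coeff_one nc_deriv_coeff_zero)
qed

lemma nc_deriv_exists:
  "\<exists>D. nc_derivation D \<and> (\<forall>i. D (nc_var i) = u $ i)"
proof (intro exI conjI allI)
  show "nc_derivation (\<lambda>U. Abs_ncfps (\<lambda>w. nc_deriv_coeff u w U))"
    unfolding nc_derivation_def
    by (intro conjI allI; rule nc_eqI)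
       (simp_all add: nc_deriv_coeff_add nc_deriv_coeff_scale nc_deriv_coeff_mult)
  show "Abs_ncfps (\<lambda>w. nc_deriv_coeff u w (nc_var i)) = u $ i" for i
    by (rule nc_eqI) (simp add: nc_deriv_coeff_var)
qed

lemma nc_derivation_eqI:
  fixes D E :: "('r::comm_ring_1, 'n::finite) ncfps \<Rightarrow> ('r, 'n) ncfps"
  assumes D: "nc_derivation D" and E: "nc_derivation E"
    and eq: "\<And>i. D (nc_var i) = E (nc_var i)"
  shows "D = E"
proof -
  have additive: "T (\<Sum>x\<in>A. f x) = (\<Sum>x\<in>A. T (f x))"
    if "nc_derivation T" for T and f :: "'n \<Rightarrow> ('r, 'n) ncfps" and A
  proof -
    have add: "T (U + V) = T U + T V" for U V
      using that by (simp add: nc_derivation_def)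
    have "T 0 = 0" using add[of 0 0] by simp
    thus ?thesis
      by (induction A rule: infinite_finite_induct) (simp_all add: add)
  qed
  have one: "T 1 = 0" if "nc_derivation T" for T :: "('r, 'n) ncfps \<Rightarrow> ('r, 'n) ncfps"
  proof -
    have "T (1 * 1) = T 1 * 1 + 1 * T 1"
      using that unfolding nc_derivation_def by blast
    thus ?thesis by simp
  qed
  have rec: "T U = (\<Sum>x\<in>UNIV. T (nc_var x) * nc_shift x U + nc_var x * T (nc_shift x U))"
    if "nc_derivation T" for T :: "('r, 'n) ncfps \<Rightarrow> ('r, 'n) ncfps" and U
  proof -
    have "T U = T (nc_scale (nc_nth U []) 1 + (\<Sum>x\<in>UNIV. nc_var x * nc_shift x U))"
      by (rule arg_cong[OF nc_decompose])
    also have "\<dots> = nc_scale (nc_nth U []) (T 1) + (\<Sum>x\<in>UNIV. T (nc_var x * nc_shift x U))"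
      using that by (simp add: nc_derivation_def additive[OF that])
    also have "nc_scale (nc_nth U []) (T 1) = 0"
      by (rule nc_eqI) (simp add: one[OF that])
    finally show ?thesis
      using that by (simp add: nc_derivation_def)
  qed
  have "nc_nth (D U) w = nc_nth (E U) w" for U w
  proof (induction w arbitrary: U)
    case Nil
    show ?case
      by (subst (1) rec[OF D], subst (1) rec[OF E]) (simp add: nc_nth_sum eq nc_nth_var)
  next
    case (Cons y w)
    show ?case
      by (subst (1) rec[OF D], subst (1) rec[OF E])
         (simp add: nc_nth_sum eq nc_nth_var_mult_Cons Cons.IH cong: if_cong)
  qed
  thus ?thesis by (intro ext nc_eqI)
qed

lemma nc_deriv_unique_existence:
  "\<exists>!D. nc_derivation D \<and> (\<forall>i. D (nc_var i) = u $ i)"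
proof -
  obtain D where D: "nc_derivation D" "\<And>i. D (nc_var i) = u $ i"
    using nc_deriv_exists by blast
  show ?thesis
  proof (rule ex1I[of _ D])
    fix E assume "nc_derivation E \<and> (\<forall>i. E (nc_var i) = u $ i)"
    thus "E = D" using D by (intro nc_derivation_eqI) auto
  qed (use D in blast)
qed

lemma nc_deriv_derivation: "nc_derivation (nc_deriv u)"
  and nc_deriv_var: "nc_deriv u (nc_var i) = u $ i"
  using theI'[OF nc_deriv_unique_existence[of u]] by (auto simp: nc_deriv_def)


section \<open>Series over \<open>k[[t]]\<close>\<close>

definition nc_vec_map ::
    "('r \<Rightarrow> 's) \<Rightarrow> ('r, 'n) ncfps ^ 'n::finite \<Rightarrow> ('s, 'n) ncfps ^ 'n" where
  "nc_vec_map f U = (\<chi> i. nc_map f (U $ i))"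

definition nc_vec_scale ::
    "'r::comm_ring_1 \<Rightarrow> ('r, 'n) ncfps ^ 'n::finite \<Rightarrow> ('r, 'n) ncfps ^ 'n" where
  "nc_vec_scale c U = (\<chi> i. nc_scale c (U $ i))"

definition t_embed :: "('k::comm_ring_1, 'n) ncfps ^ 'n::finite \<Rightarrow> ('k fps, 'n) ncfps ^ 'n" where
  "t_embed H = nc_vec_map fps_const H"

definition t_derivative ::
    "('k::comm_ring_1 fps, 'n) ncfps ^ 'n::finite \<Rightarrow> ('k fps, 'n) ncfps ^ 'n" where
  "t_derivative N = nc_vec_map fps_deriv N"

definition t_at_0 :: "('k::comm_ring_1 fps, 'n) ncfps ^ 'n::finite \<Rightarrow> ('k, 'n) ncfps ^ 'n" where
  "t_at_0 N = nc_vec_map (\<lambda>c. fps_nth c 0) N"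

definition cauchy_solution ::
    "('k::comm_ring_1, 'n::finite) ncfps ^ 'n \<Rightarrow> ('k fps, 'n) ncfps ^ 'n \<Rightarrow> bool" where
  "cauchy_solution H N \<longleftrightarrow> t_derivative N = nc_vec_deriv N N \<and> t_at_0 N = H"

end

theory Submission
  imports Defs
begin

text \<open>
  Substitution of \<open>F = z - tH\<close> is an injective algebra endomorphism, being the identity modulo
  \<open>t\<close>. Hence \<open>G = z + tN\<close> inverts \<open>F\<close> iff \<open>G(F) = z\<close>, i.e. iff \<open>W = H\<close> for \<open>W = N(F)\<close>. The chain
  rule gives \<open>\<partial>W/\<partial>t = (\<partial>N/\<partial>t - [N \<partial>/\<partial>z] N)(F) + \<Delta> N\<close>, where \<open>\<Delta>\<close> is the derivation along
  substitution of \<open>F\<close> sending \<open>z\<^sub>i\<close> to \<open>W\<^sub>i - H\<^sub>i\<close>. If \<open>W = H\<close>, then \<open>\<Delta> = 0\<close> and injectivity yields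
  the differential equation. Conversely, if \<open>N\<close> solves the Cauchy problem, then \<open>W - H\<close> solves a
  linear equation with initial value \<open>0\<close>, so every power of \<open>t\<close> divides it.
\<close>

text \<open>As \<open>A\<close> has no constant term, every contributing splitting of
  \<open>w\<close> has a nonempty left part, so \<open>P\<close> enters only through words shorter
  than \<open>w\<close>. This drives the inductions on word length below.\<close>

lemma nc_nth_mult_cong:
  assumes "nc_nth A [] = 0" and "\<And>v. length v < length w \<Longrightarrow> nc_nth P v = nc_nth Q v"
  shows "nc_nth (A * P) w = nc_nth (A * Q) w"
  unfolding nc_nth_mult
proof (rule sum.cong)
  fix i assume "i \<in> {0..length w}"
  show "nc_nth A (take i w) * nc_nth P (drop i w) = nc_nth A (take i w) * nc_nth Q (drop i w)"
  proof (cases "take i w = []")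
    case True
    thus ?thesis by (simp only: True assms(1) mult_zero_left)
  next
    case False
    hence "length (drop i w) < length w" by (cases w; cases i) auto
    thus ?thesis using assms(2) by simp
  qed
qed simp

lemma nc_scale_add: "nc_scale c (U + V) = nc_scale c U + nc_scale c V"
  by (rule nc_eqI) (simp add: algebra_simps)

lemma nc_scale_sum: "nc_scale c (\<Sum>i\<in>A. f i) = (\<Sum>i\<in>A. nc_scale c (f i))"
  by (rule nc_eqI) (simp add: nc_nth_sum sum_distrib_left)


section \<open>Substitution\<close>

lemma nc_nth_prod_list_eq_0:
  assumes "\<And>i. nc_nth (F $ i) [] = 0" and "length w < length v"
  shows "nc_nth (prod_list (map (\<lambda>i. F $ i) v)) w = 0"
  using assms(2)
proof (induction v arbitrary: w)
  case (Cons x v)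
  have "nc_nth (F $ x * prod_list (map (\<lambda>i. F $ i) v)) w = nc_nth (F $ x * 0) w"
    by (rule nc_nth_mult_cong) (use Cons assms(1) in auto)
  thus ?case by simp
qed simp

text \<open>Words longer than \<open>w\<close> contribute 0, so every cutoff \<open>n\<close> from
  \<open>length w\<close> on is allowed. One common cutoff can then serve all suffixes of a given
  word.\<close>

lemma nc_nth_subst:
  fixes F :: "('r::comm_ring_1, 'n::finite) ncfps ^ 'n"
  assumes F: "\<And>i. nc_nth (F $ i) [] = 0" and "length w \<le> n"
  shows "nc_nth (nc_subst U F) w =
    (\<Sum>v | length v \<le> n. nc_nth U v * nc_nth (prod_list (map (\<lambda>i. F $ i) v)) w)"
  unfolding nc_subst_def nc_nth_Abs
proof (rule sum.mono_neutral_left)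
  show "finite {v :: 'n list. length v \<le> n}"
    using finite_lists_length_le[of "UNIV :: 'n set" n] by simp
qed (use assms in \<open>auto simp: nc_nth_prod_list_eq_0\<close>)

lemma sum_words_Suc:
  fixes f :: "'n::finite list \<Rightarrow> 'b::comm_monoid_add"
  shows "(\<Sum>v | length v \<le> Suc n. f v) = f [] + (\<Sum>x\<in>UNIV. \<Sum>v | length v \<le> n. f (x # v))"
proof -
  have fin: "finite {v :: 'n list. length v \<le> n}"
    using finite_lists_length_le[of "UNIV :: 'n set" n] by simp
  let ?C = "(\<lambda>(x, v). x # v) ` (UNIV \<times> {v :: 'n list. length v \<le> n})"
  have "{v :: 'n list. length v \<le> Suc n} = insert [] ?C"
    by (auto simp: image_iff) (metis Suc_le_mono length_Cons list.exhaust)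
  moreover have "[] \<notin> ?C" "finite ?C" using fin by auto
  ultimately have "(\<Sum>v | length v \<le> Suc n. f v) = f [] + sum f ?C" by simp
  also have "sum f ?C = (\<Sum>(x, v)\<in>UNIV \<times> {v. length v \<le> n}. f (x # v))"
    by (subst sum.reindex) (auto simp: inj_on_def case_prod_unfold)
  finally show ?thesis by (simp add: sum.cartesian_product)
qed

text \<open>The image of \<open>nc_decompose\<close> under substitution. As \<open>F\<close> has no
  constant terms, coefficients on the right involve the inner series only at shorter words;
  multiplicativity and associativity of substitution are deduced from this recursion.\<close>

lemma nc_subst_rec:
  fixes F :: "('r::comm_ring_1, 'n::finite) ncfps ^ 'n"
  assumes F: "\<And>i. nc_nth (F $ i) [] = 0"
  shows "nc_subst U F = nc_scale (nc_nth U []) 1 + (\<Sum>x\<in>UNIV. F $ x * nc_subst (nc_shift x U) F)"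
proof (rule nc_eqI)
  fix w :: "'n list"
  let ?P = "\<lambda>v. prod_list (map (\<lambda>i. F $ i) v)"
  let ?L = "{v :: 'n list. length v \<le> length w}"
  have 1: "nc_nth (F $ x * nc_subst (nc_shift x U) F) w =
      (\<Sum>v\<in>?L. nc_nth U (x # v) * nc_nth (F $ x * ?P v) w)" for x
  proof -
    have "nc_nth (F $ x * nc_subst (nc_shift x U) F) w =
       (\<Sum>i=0..length w. \<Sum>v\<in>?L. nc_nth U (x # v) * (nc_nth (F $ x) (take i w) * nc_nth (?P v) (drop i w)))"
      unfolding nc_nth_mult
      by (intro sum.cong refl)
        (simp add: nc_nth_subst[OF F, of _ "length w"] sum_distrib_left mult.left_commute)
    also have "\<dots> = (\<Sum>v\<in>?L. nc_nth U (x # v) * nc_nth (F $ x * ?P v) w)"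
      by (subst sum.swap) (simp add: nc_nth_mult sum_distrib_left)
    finally show ?thesis .
  qed
  \<comment> \<open>The cutoff is one above \<open>length w\<close>, so that removing the first
    letter leaves exactly the words in \<open>?L\<close>.\<close>
  have "nc_nth (nc_subst U F) w = (\<Sum>v | length v \<le> Suc (length w). nc_nth U v * nc_nth (?P v) w)"
    by (rule nc_nth_subst[OF F]) auto
  also have "\<dots> = nc_nth U [] * nc_nth 1 w +
      (\<Sum>x\<in>UNIV. \<Sum>v\<in>?L. nc_nth U (x # v) * nc_nth (F $ x * ?P v) w)"
    by (simp add: sum_words_Suc)
  finally show "nc_nth (nc_subst U F) w =
      nc_nth (nc_scale (nc_nth U []) 1 + (\<Sum>x\<in>UNIV. F $ x * nc_subst (nc_shift x U) F)) w"
    by (simp add: 1 nc_nth_sum)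
qed

lemma nc_subst_add: "nc_subst (U + V) F = nc_subst U F + nc_subst V F"
  by (rule nc_eqI) (simp add: nc_subst_def algebra_simps sum.distrib)

lemma nc_subst_scale: "nc_subst (nc_scale c U) F = nc_scale c (nc_subst U F)"
  by (rule nc_eqI) (simp add: nc_subst_def sum_distrib_left mult.assoc)

lemma nc_subst_zero [simp]: "nc_subst 0 F = 0"
  by (rule nc_eqI) (simp add: nc_subst_def)

lemma nc_subst_diff: "nc_subst (U - V) F = nc_subst U F - nc_subst V F"
  by (rule nc_eqI) (simp add: nc_subst_def algebra_simps sum_subtractf)

lemma nc_subst_sum: "nc_subst (\<Sum>i\<in>A. f i) F = (\<Sum>i\<in>A. nc_subst (f i) F)"
  by (induction A rule: infinite_finite_induct) (simp_all add: nc_subst_add)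

lemma nc_shift_one [simp]: "nc_shift x 1 = 0"
  by (rule nc_eqI) (simp add: nc_nth_one)

lemma nc_subst_one:
  assumes "\<And>i. nc_nth (F $ i) [] = 0"
  shows "nc_subst 1 F = 1"
  by (subst nc_subst_rec[OF assms]) (auto intro!: nc_eqI simp: nc_nth_one)

lemma nc_subst_var:
  assumes "\<And>i. nc_nth (F $ i) [] = 0"
  shows "nc_subst (nc_var j) F = F $ j"
proof -
  have "F $ x * nc_subst (nc_shift x (nc_var j)) F = (if x = j then F $ j else 0)" for x
    by (simp add: nc_shift_var nc_subst_one[OF assms])
  moreover have "nc_scale (nc_nth (nc_var j) []) 1 = 0"
    by (rule nc_eqI) (simp add: nc_nth_var)
  ultimately show ?thesis
    by (subst nc_subst_rec[OF assms]) simp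
qed

text \<open>For fixed \<open>V\<close>, both sides obey the same recursion in \<open>U\<close>,
  which determines coefficients by induction on word length.\<close>

lemma nc_subst_mult:
  assumes F: "\<And>i. nc_nth (F $ i) [] = 0"
  shows "nc_subst (U * V) F = nc_subst U F * nc_subst V F"
proof (rule nc_eqI)
  note rec = nc_subst_rec[OF F]
  let ?S = "\<lambda>U. nc_subst U F"
  fix w
  show "nc_nth (?S (U * V)) w = nc_nth (?S U * ?S V) w"
  proof (induction "length w" arbitrary: U V w rule: less_induct)
    case less
    let ?c = "nc_nth U []"
    have "?S (U * V) = nc_scale (?c * nc_nth V []) 1 +
        (\<Sum>x\<in>UNIV. F $ x * nc_scale ?c (?S (nc_shift x V))) + (\<Sum>x\<in>UNIV. F $ x * ?S (nc_shift x U * V))"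
      by (subst rec) (simp add: nc_shift_mult nc_subst_add nc_subst_scale distrib_left sum.distrib)
    \<comment> \<open>The terms carrying the constant term of \<open>U\<close> reassemble to a
      multiple of \<open>?S V\<close> by the recursion for \<open>V\<close>.\<close>
    also have "\<dots> = nc_scale ?c (?S V) + (\<Sum>x\<in>UNIV. F $ x * ?S (nc_shift x U * V))"
      by (subst (2) rec) (auto intro!: nc_eqI
        simp: nc_scale_add nc_scale_sum nc_scale_mult_right nc_nth_sum mult.assoc)
    finally have 1: "?S (U * V) = nc_scale ?c (?S V) + (\<Sum>x\<in>UNIV. F $ x * ?S (nc_shift x U * V))" .
    have 2: "?S U * ?S V = nc_scale ?c (?S V) + (\<Sum>x\<in>UNIV. F $ x * (?S (nc_shift x U) * ?S V))"
      by (subst rec) (simp add: distrib_right sum_distrib_right nc_scale_mult_left mult.assoc)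
    have "nc_nth (F $ x * ?S (nc_shift x U * V)) w =
        nc_nth (F $ x * (?S (nc_shift x U) * ?S V)) w" for x
      by (rule nc_nth_mult_cong[OF F]) (rule less)
    thus ?case by (simp add: 1 2 nc_nth_sum)
  qed
qed

lemma nc_subst_vars [simp]: "nc_subst U (nc_vars :: ('r::comm_ring_1, 'n::finite) ncfps ^ 'n) = U"
proof (rule nc_eqI)
  have z: "nc_nth ((nc_vars :: ('r, 'n) ncfps ^ 'n) $ i) [] = 0" for i
    by (simp add: nc_vars_def nc_nth_var)
  fix w show "nc_nth (nc_subst U nc_vars) w = nc_nth U w"
  proof (induction w arbitrary: U)
    case Nil show ?case
      by (subst nc_subst_rec[OF z]) (simp add: nc_nth_sum z nc_nth_one)
  next
    case (Cons y w) thus ?case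
      by (subst nc_subst_rec[OF z])
        (simp add: nc_nth_sum nc_vars_def nc_nth_one nc_nth_var_mult_Cons cong: if_cong)
  qed
qed

text \<open>Substitution of \<open>F\<close> is an algebra homomorphism, hence turns the recursion
  for \<open>G\<close> into the one for \<open>G(F)\<close>.\<close>

lemma nc_subst_subst:
  assumes F: "\<And>i. nc_nth (F $ i) [] = 0" and G: "\<And>i. nc_nth (G $ i) [] = 0"
  shows "nc_subst (nc_subst U G) F = nc_subst U (nc_vec_subst G F)"
proof (rule nc_eqI)
  have GF: "nc_nth (nc_vec_subst G F $ i) [] = 0" for i
    by (simp add: nc_vec_subst_def nc_subst_def G)
  fix w show "nc_nth (nc_subst (nc_subst U G) F) w = nc_nth (nc_subst U (nc_vec_subst G F)) w"
  proof (induction "length w" arbitrary: U w rule: less_induct)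
    case less
    have "nc_nth (nc_vec_subst G F $ x * nc_subst (nc_subst (nc_shift x U) G) F) w =
        nc_nth (nc_vec_subst G F $ x * nc_subst (nc_shift x U) (nc_vec_subst G F)) w" for x
      by (rule nc_nth_mult_cong[OF GF]) (rule less)
    thus ?case
      by (subst nc_subst_rec[OF G], subst nc_subst_rec[OF GF])
        (simp add: nc_subst_add nc_subst_sum nc_subst_scale nc_subst_one[OF F]
          nc_subst_mult[OF F] nc_nth_sum, simp add: nc_vec_subst_def)
  qed
qed


section \<open>Derivations\<close>

lemma nc_derivation_add: "nc_derivation D \<Longrightarrow> D (U + V) = D U + D V"
  and nc_derivation_scale: "nc_derivation D \<Longrightarrow> D (nc_scale c U) = nc_scale c (D U)"
  and nc_derivation_mult: "nc_derivation D \<Longrightarrow> D (U * V) = D U * V + U * D V"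
  unfolding nc_derivation_def by blast+

lemmas nc_deriv_add = nc_derivation_add[OF nc_deriv_derivation]
  and nc_deriv_scale = nc_derivation_scale[OF nc_deriv_derivation]
  and nc_deriv_mult = nc_derivation_mult[OF nc_deriv_derivation]

lemma nc_deriv_zero [simp]: "nc_deriv u 0 = 0"
  using nc_deriv_add[of u 0 0] by simp

lemma nc_deriv_one [simp]: "nc_deriv u 1 = 0"
  using nc_deriv_mult[of u 1 1] by simp

lemma nc_deriv_sum: "nc_deriv u (\<Sum>i\<in>A. f i) = (\<Sum>i\<in>A. nc_deriv u (f i))"
  by (induction A rule: infinite_finite_induct) (simp_all add: nc_deriv_add)

lemma nc_deriv_rec:
  "nc_deriv u U = (\<Sum>x\<in>UNIV. u $ x * nc_shift x U + nc_var x * nc_deriv u (nc_shift x U))"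
proof -
  have "nc_scale c 0 = (0 :: ('a, 'b) ncfps)" for c by (rule nc_eqI) simp
  thus ?thesis
    by (subst nc_decompose[of U])
      (simp add: nc_deriv_add nc_deriv_scale nc_deriv_sum nc_deriv_mult nc_deriv_var)
qed

lemma nc_deriv_diff: "nc_deriv u (U - V) = nc_deriv u U - nc_deriv u V"
  using nc_deriv_add[of u "U - V" V] by simp

text \<open>The right-hand side is a derivation in \<open>U\<close> with the same values at the
  variables, so uniqueness applies.\<close>

lemma nc_deriv_diff_left: "nc_deriv (u - v) U = nc_deriv u U - nc_deriv v U"
proof -
  have "nc_derivation (\<lambda>U. nc_deriv u U - nc_deriv v U)"
    unfolding nc_derivation_def
    by (auto simp: nc_deriv_add nc_deriv_scale nc_deriv_mult algebra_simps intro!: nc_eqI)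
  from nc_derivation_eqI[OF nc_deriv_derivation this, of "u - v"] show ?thesis
    by (simp add: nc_deriv_var fun_eq_iff)
qed


section \<open>Divisibility of all coefficients\<close>

text \<open>Used with powers of \<open>fps_X\<close> for congruences in the \<open>t\<close>-adic
  topology, and with \<open>c = 0\<close> to express vanishing.\<close>

definition nc_dvd :: "'r::comm_ring_1 \<Rightarrow> ('r, 'n) ncfps \<Rightarrow> bool" where
  "nc_dvd c U \<longleftrightarrow> (\<forall>w. c dvd nc_nth U w)"

lemma nc_dvd_add: "nc_dvd c U \<Longrightarrow> nc_dvd c V \<Longrightarrow> nc_dvd c (U + V)"
  and nc_dvd_mult_left: "nc_dvd c U \<Longrightarrow> nc_dvd c (U * V)"
  and nc_dvd_mult_right: "nc_dvd c V \<Longrightarrow> nc_dvd c (U * V)"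
  by (auto simp: nc_dvd_def nc_nth_mult intro!: dvd_sum)

lemma nc_dvdE:
  assumes "nc_dvd c U" obtains V where "U = nc_scale c V"
proof -
  from assms obtain f where "\<And>w. nc_nth U w = c * f w"
    unfolding nc_dvd_def dvd_def by metis
  hence "U = nc_scale c (Abs_ncfps f)" by (intro nc_eqI) simp
  thus ?thesis by (rule that)
qed

lemma nc_dvd_scale: "nc_dvd c (nc_scale c U)"
  by (simp add: nc_dvd_def)

lemma nc_dvd_scale_mono: "nc_dvd c U \<Longrightarrow> nc_dvd (d * c) (nc_scale d U)"
  by (simp add: nc_dvd_def mult_dvd_mono)

lemma dvd_nc_nth_mult:
  assumes "nc_nth A [] = 0" and "\<And>v. length v < length w \<Longrightarrow> c dvd nc_nth P v"
  shows "c dvd nc_nth (A * P) w"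
proof -
  \<comment> \<open>Truncating \<open>P\<close> to words shorter than \<open>w\<close> does not
    change the coefficient and makes divisibility hold everywhere.\<close>
  define Q where "Q = Abs_ncfps (\<lambda>v. if length v < length w then nc_nth P v else 0)"
  have "nc_nth (A * P) w = nc_nth (A * Q) w"
    by (rule nc_nth_mult_cong) (auto simp: assms(1) Q_def)
  moreover have "nc_dvd c Q" by (auto simp: nc_dvd_def Q_def assms(2))
  ultimately show ?thesis using nc_dvd_mult_right[of c Q A] by (simp add: nc_dvd_def)
qed

text \<open>A derivation \<open>T\<close> along \<open>U \<mapsto> U(F)\<close> satisfies the equation with
  \<open>A x U = T z\<^sub>x * (nc_shift x U)(F)\<close>.\<close>

lemma nc_dvd_rec:
  assumes F: "\<And>x. nc_nth (F $ x) [] = 0"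
    and T: "\<And>U. T U = (\<Sum>x\<in>UNIV. A x U + F $ x * T (nc_shift x U))"
    and A: "\<And>x U. nc_dvd c (A x U)"
  shows "nc_dvd c (T U)"
proof -
  have "c dvd nc_nth (T U) w" for w
  proof (induction "length w" arbitrary: U w rule: less_induct)
    case less
    have "c dvd nc_nth (F $ x * T (nc_shift x U)) w" for x
      by (rule dvd_nc_nth_mult[OF F]) (rule less)
    with A show ?case
      by (subst T) (auto simp: nc_nth_sum nc_dvd_def intro!: dvd_sum dvd_add)
  qed
  thus ?thesis by (simp add: nc_dvd_def)
qed

lemma nc_dvd_deriv:
  assumes "\<And>x. nc_dvd c (u $ x)"
  shows "nc_dvd c (nc_deriv u U)"
proof (rule nc_dvd_rec[of nc_vars "nc_deriv u"])
  fix U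
  show "nc_deriv u U = (\<Sum>x\<in>UNIV. u $ x * nc_shift x U + nc_vars $ x * nc_deriv u (nc_shift x U))"
    by (subst nc_deriv_rec) (simp add: nc_vars_def)
qed (auto simp: nc_vars_def nc_nth_var assms intro: nc_dvd_mult_left)

text \<open>A substitution congruent to the identity modulo \<open>c\<close> on the variables is so
  on all series: the difference satisfies \<open>nc_dvd_rec\<close> with source terms divisible by
  \<open>F $ x - nc_var x\<close>.\<close>

lemma nc_dvd_subst_diff:
  assumes F: "\<And>i. nc_nth (F $ i) [] = 0" and "\<And>i. nc_dvd c (F $ i - nc_var i)"
  shows "nc_dvd c (nc_subst U F - U)"
proof (rule nc_dvd_rec[of nc_vars "\<lambda>U. nc_subst U F - U"])
  fix U
  show "nc_subst U F - U = (\<Sum>x\<in>UNIV. (F $ x - nc_var x) * nc_subst (nc_shift x U) F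
      + nc_vars $ x * (nc_subst (nc_shift x U) F - nc_shift x U))"
    by (subst nc_subst_rec[OF F], subst (3) nc_decompose)
      (simp add: nc_vars_def algebra_simps sum.distrib sum_subtractf)
qed (auto simp: nc_vars_def nc_nth_var assms intro: nc_dvd_mult_left)


section \<open>Coefficients in \<open>k[[t]]\<close>\<close>

lemma fps_X_power_dvd_iff: "fps_X ^ m dvd f \<longleftrightarrow> (\<forall>i<m. fps_nth f i = 0)"
  for f :: "'k::comm_ring_1 fps"
proof
  assume "\<forall>i<m. fps_nth f i = 0"
  hence "f = fps_X ^ m * fps_shift m f"
    by (intro fps_ext) (auto simp: fps_X_power_mult_nth)
  thus "fps_X ^ m dvd f" by (rule dvdI)
qed (auto simp: dvd_def fps_X_power_mult_nth)

text \<open>Integration from 0 gains one power of \<open>t\<close>. Characteristic zero enters here,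
  to cancel the factor \<open>j + 1\<close> produced by differentiation.\<close>

lemma fps_X_power_Suc_dvd:
  fixes f :: "'k::{idom, ring_char_0} fps"
  assumes "fps_X ^ m dvd fps_deriv f" and "fps_nth f 0 = 0"
  shows "fps_X ^ Suc m dvd f"
proof -
  have "fps_nth f i = 0" if "i < Suc m" for i
  proof (cases i)
    case (Suc j)
    hence "fps_nth (fps_deriv f) j = 0" using assms(1) that by (simp add: fps_X_power_dvd_iff)
    hence "of_nat (Suc j) * fps_nth f (Suc j) = 0" by simp
    thus ?thesis using Suc of_nat_neq_0[of j, where ?'a = 'k] by (simp del: of_nat_Suc)
  qed (simp add: assms)
  thus ?thesis by (subst fps_X_power_dvd_iff) blast
qed

lemma nc_eq_0_if_all_powers_dvd:
  fixes U :: "('k::comm_ring_1 fps, 'n) ncfps"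
  assumes "\<And>m. nc_dvd (fps_X ^ m) U"
  shows "U = 0"
proof (rule nc_eqI, rule fps_ext)
  fix w m
  show "fps_nth (nc_nth U w) m = fps_nth (nc_nth 0 w) m"
    using assms[of "Suc m"] unfolding nc_dvd_def fps_X_power_dvd_iff by simp
qed

abbreviation nc_dt :: "('k::comm_ring_1 fps, 'n) ncfps \<Rightarrow> ('k fps, 'n) ncfps" where
  "nc_dt \<equiv> nc_map fps_deriv"

lemma nc_nth_map [simp]: "nc_nth (nc_map f U) w = f (nc_nth U w)"
  by (simp add: nc_map_def)

lemma nc_dt_add: "nc_dt (U + V) = nc_dt U + nc_dt V"
  and nc_dt_diff: "nc_dt (U - V) = nc_dt U - nc_dt V"
  by (rule nc_eqI, simp)+

lemma nc_dt_sum: "nc_dt (\<Sum>i\<in>A. f i) = (\<Sum>i\<in>A. nc_dt (f i))"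
  by (rule nc_eqI) (simp add: nc_nth_sum fps_deriv_sum)

lemma nc_dt_mult: "nc_dt (U * V) = nc_dt U * V + U * nc_dt V"
  by (rule nc_eqI) (simp add: nc_nth_mult fps_deriv_sum sum.distrib algebra_simps)

lemma nc_dt_scale_one: "nc_dt (nc_scale c 1) = nc_scale (fps_deriv c) 1"
  by (rule nc_eqI) (simp add: nc_nth_one)

lemma nc_dt_shift: "nc_shift x (nc_dt U) = nc_dt (nc_shift x U)"
  by (rule nc_eqI) simp

text \<open>A Gronwall argument in the \<open>t\<close>-adic topology.\<close>

lemma nc_vec_eq_0_if_dt_dvd:
  fixes E :: "('k::{idom, ring_char_0} fps, 'n::finite) ncfps ^ 'n"
  assumes "\<And>m i. (\<And>j. nc_dvd (fps_X ^ m) (E $ j)) \<Longrightarrow> nc_dvd (fps_X ^ m) (nc_dt (E $ i))"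
    and "\<And>i w. fps_nth (nc_nth (E $ i) w) 0 = 0"
  shows "E $ i = 0"
proof (rule nc_eq_0_if_all_powers_dvd)
  fix m show "nc_dvd (fps_X ^ m) (E $ i)"
  proof (induction m arbitrary: i)
    case (Suc m)
    \<comment> \<open>Divisibility of \<open>E\<close> by \<open>t^m\<close> passes to its
      \<open>t\<close>-derivative; integrating with initial value 0 yields
      \<open>t^(m+1)\<close>.\<close>
    from assms(1)[OF this] show ?case
      using assms(2) fps_X_power_Suc_dvd unfolding nc_dvd_def nc_nth_map by blast
  qed (simp add: nc_dvd_def)
qed

section \<open>The Cauchy problem and uniqueness of its solution\<close>

lemma cauchy_solution_iff:
  fixes H :: "('k::comm_ring_1, 'n::finite) ncfps ^ 'n"
  shows
  "cauchy_solution H N \<longleftrightarrow>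
    (\<forall>i. nc_dt (N $ i) = nc_deriv N (N $ i)) \<and> (\<forall>i w. fps_nth (nc_nth (N $ i) w) 0 = nc_nth (H $ i) w)"
proof -
  have "U = V \<longleftrightarrow> (\<forall>w. nc_nth U w = nc_nth V w)" for U V :: "('k, 'n) ncfps"
    by (auto intro: nc_eqI)
  thus ?thesis
    by (simp add: cauchy_solution_def t_derivative_def t_at_0_def nc_vec_map_def nc_vec_deriv_def
        vec_eq_iff)
qed

text \<open>The difference \<open>E = M - N\<close> satisfies the linear equation
  \<open>dE/dt = [E d/dz] M + [N d/dz] E\<close> with initial value 0, to which the Gronwall
  argument applies.\<close>

lemma cauchy_solution_unique:
  fixes H :: "('k::{idom, ring_char_0}, 'n::finite) ncfps ^ 'n"
  assumes "cauchy_solution H M" and "cauchy_solution H N"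
  shows "M = N"
proof -
  have "(M - N) $ i = 0" for i
  proof (rule nc_vec_eq_0_if_dt_dvd)
    fix m i
    assume IH: "\<And>j. nc_dvd (fps_X ^ m) ((M - N) $ j)"
    have "nc_dt ((M - N) $ i) = nc_deriv (M - N) (M $ i) + nc_deriv N ((M - N) $ i)"
      using assms by (simp add: cauchy_solution_iff nc_dt_diff nc_deriv_diff nc_deriv_diff_left)
    moreover obtain V where "(M - N) $ i = nc_scale (fps_X ^ m) V"
      using IH nc_dvdE by blast
    ultimately show "nc_dvd (fps_X ^ m) (nc_dt ((M - N) $ i))"
      using IH by (simp add: nc_deriv_scale nc_dvd_add nc_dvd_deriv nc_dvd_scale)
  qed (use assms in \<open>simp add: cauchy_solution_iff\<close>)
  thus ?thesis by (simp add: vec_eq_iff)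
qed

section \<open>Injectivity of substitution and the chain rule\<close>

text \<open>If \<open>U - V = t^m W\<close>, then \<open>t^m W(F) = 0\<close>, so
  \<open>W(F) = 0\<close> as there are no zero divisors. Since \<open>W(F)\<close> and
  \<open>W\<close> agree modulo \<open>t\<close>, one more power of \<open>t\<close> divides
  \<open>U - V\<close>.\<close>

lemma nc_subst_inject:
  fixes F :: "('k::idom fps, 'n::finite) ncfps ^ 'n"
  assumes F: "\<And>i. nc_nth (F $ i) [] = 0" "\<And>i. nc_dvd fps_X (F $ i - nc_var i)"
    and eq: "nc_subst U F = nc_subst V F"
  shows "U = V"
proof -
  have "U - V = 0"
  proof (rule nc_eq_0_if_all_powers_dvd)
    fix m show "nc_dvd (fps_X ^ m) (U - V)"
    proof (induction m)
      case (Suc m)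
      then obtain W where W: "U - V = nc_scale (fps_X ^ m) W" by (rule nc_dvdE)
      have "nc_scale (fps_X ^ m) (nc_subst W F) = 0"
        using eq by (simp flip: W nc_subst_scale add: nc_subst_diff)
      hence "nc_subst W F = 0"
        by (intro nc_eqI) (drule arg_cong[of _ _ "\<lambda>U. nc_nth U _"], simp)
      hence "nc_dvd fps_X W"
        using nc_dvd_subst_diff[OF F, of W] by (simp add: nc_dvd_def)
      thus ?case unfolding W power_Suc2 by (rule nc_dvd_scale_mono)
    qed (simp add: nc_dvd_def)
  qed
  thus ?thesis by simp
qed

text \<open>
  Both \<open>U \<mapsto> \<partial>(U(F))/\<partial>t - (\<partial>U/\<partial>t)(F)\<close> and \<open>U \<mapsto> ([u \<partial>/\<partial>z] U)(F)\<close> are derivations along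
  \<open>U \<mapsto> U(F)\<close>, with values \<open>\<partial>F\<^sub>i/\<partial>t\<close> and \<open>u\<^sub>i(F)\<close> at \<open>z\<^sub>i\<close>. For \<open>c = 0\<close> divisibility means that the sum vanishes.
\<close>

lemma nc_dvd_chain_rule:
  fixes F :: "('k::comm_ring_1 fps, 'n::finite) ncfps ^ 'n"
  assumes F: "\<And>i. nc_nth (F $ i) [] = 0"
    and "\<And>i. nc_dvd c (nc_subst (u $ i) F + nc_dt (F $ i))"
  shows "nc_dvd c (nc_dt (nc_subst U F) - nc_subst (nc_dt U) F + nc_subst (nc_deriv u U) F)"
proof (rule nc_dvd_rec[where F = F and
    T = "\<lambda>U. nc_dt (nc_subst U F) - nc_subst (nc_dt U) F + nc_subst (nc_deriv u U) F"])
  fix U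
  let ?S = "\<lambda>U. nc_subst U F"
  have 1: "nc_dt (?S U) = nc_scale (fps_deriv (nc_nth U [])) 1 +
      (\<Sum>x\<in>UNIV. nc_dt (F $ x) * ?S (nc_shift x U) + F $ x * nc_dt (?S (nc_shift x U)))"
    by (subst nc_subst_rec[OF F]) (simp add: nc_dt_add nc_dt_sum nc_dt_mult nc_dt_scale_one)
  have 2: "?S (nc_dt U) = nc_scale (fps_deriv (nc_nth U [])) 1 +
      (\<Sum>x\<in>UNIV. F $ x * ?S (nc_dt (nc_shift x U)))"
    by (subst nc_subst_rec[OF F]) (simp add: nc_dt_shift)
  have 3: "?S (nc_deriv u U) =
      (\<Sum>x\<in>UNIV. ?S (u $ x) * ?S (nc_shift x U) + F $ x * ?S (nc_deriv u (nc_shift x U)))"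
    by (subst nc_deriv_rec)
      (simp add: nc_subst_sum nc_subst_add nc_subst_mult[OF F] nc_subst_var[OF F])
  \<comment> \<open>The constant terms in 1 and 2 cancel; what remains is the recursion required by
    \<open>nc_dvd_rec\<close>.\<close>
  show "nc_dt (?S U) - ?S (nc_dt U) + ?S (nc_deriv u U) =
      (\<Sum>x\<in>UNIV. (?S (u $ x) + nc_dt (F $ x)) * ?S (nc_shift x U) +
        F $ x * (nc_dt (?S (nc_shift x U)) - ?S (nc_dt (nc_shift x U)) + ?S (nc_deriv u (nc_shift x U))))"
    unfolding 1 2 3 by (simp add: algebra_simps sum.distrib sum_subtractf)
qed (auto simp: F intro: nc_dvd_mult_left assms)

section \<open>The equivalence\<close>

lemma nc_vec_order_nth_Nil:
  fixes U :: "('r::zero, 'n::finite) ncfps ^ 'n"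
  assumes "nc_vec_order U \<ge> 2"
  shows "nc_nth (U $ i) [] = 0"
proof (rule ccontr)
  let ?e = "[] :: 'n list"
  assume "nc_nth (U $ i) [] \<noteq> 0"
  hence "nc_order (U $ i) \<le> enat (length ?e)"
    unfolding nc_order_def by (intro INF_lower) (rule CollectI)
  moreover have "nc_vec_order U \<le> nc_order (U $ i)"
    unfolding nc_vec_order_def by (rule INF_lower) simp
  ultimately have "(2::enat) \<le> enat (length ?e)" using assms by (meson order_trans)
  thus False by (simp add: numeral_eq_enat)
qed

theorem proposition4p6:
  fixes H :: "('k::{idom, ring_char_0}, 'n::finite) ncfps ^ 'n"
    and N :: "('k fps, 'n) ncfps ^ 'n"
  assumes "nc_vec_order H \<ge> 2" and "nc_vec_order N \<ge> 2"
  shows "nc_inverse_map (nc_vars + nc_vec_scale fps_X N) (nc_vars - nc_vec_scale fps_X (t_embed H))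
     \<longleftrightarrow> cauchy_solution H N \<and> (\<forall>M. cauchy_solution H M \<longrightarrow> M = N)"
proof -
  define F where "F = nc_vars - nc_vec_scale fps_X (t_embed H)"
  define G where "G = nc_vars + nc_vec_scale fps_X N"
  define h where "h = (\<lambda>i. t_embed H $ i)"
  have h: "nc_nth (h i) w = fps_const (nc_nth (H $ i) w)" for i w
    by (simp add: h_def t_embed_def nc_vec_map_def)
  have Fi: "F $ i = nc_var i - nc_scale fps_X (h i)"
    and Gi: "G $ i = nc_var i + nc_scale fps_X (N $ i)" for i
    by (simp_all add: F_def G_def h_def nc_vars_def nc_vec_scale_def)
  have F0: "nc_nth (F $ i) [] = 0" and G0: "nc_nth (G $ i) [] = 0" for i
    using nc_vec_order_nth_Nil[OF assms(1)] nc_vec_order_nth_Nil[OF assms(2)]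
    by (simp_all add: Fi Gi h nc_nth_var)
  have FX: "nc_dvd fps_X (F $ i - nc_var i)" for i
    by (simp add: Fi nc_dvd_def)
  have dF: "nc_dt (F $ i) = - h i" for i
    by (rule nc_eqI) (simp add: Fi h nc_nth_var if_distrib[of fps_deriv])
  define W where "W = (\<lambda>i. nc_subst (N $ i) F)"
  \<comment> \<open>\<open>G(F) = F + t N(F) = z - tH + tW\<close>.\<close>
  have GF: "nc_subst (G $ i) F = nc_var i + nc_scale fps_X (W i - h i)" for i
    by (rule nc_eqI) (simp add: Gi nc_subst_add nc_subst_scale nc_subst_var[OF F0] W_def Fi algebra_simps)
  have inverse_iff: "nc_inverse_map G F \<longleftrightarrow> (\<forall>i. W i = h i)"
  proof
    assume "nc_inverse_map G F"
    hence "nc_scale fps_X (W i - h i) = 0" for i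
      using GF[of i] by (simp add: nc_inverse_map_def nc_vec_subst_def nc_vars_def vec_eq_iff)
    hence "fps_X * (nc_nth (W i) w - nc_nth (h i) w) = 0" for i w
      by (metis nc_nth_diff nc_nth_scale nc_nth_zero)
    thus "\<forall>i. W i = h i" by (auto intro!: nc_eqI)
  next
    assume W: "\<forall>i. W i = h i"
    have "nc_scale fps_X 0 = (0 :: ('k fps, 'n) ncfps)" by (rule nc_eqI) simp
    with W GF have vGF: "nc_vec_subst G F = nc_vars"
      by (simp add: nc_vec_subst_def nc_vars_def)
    \<comment> \<open>A left inverse is two-sided: \<open>F(G)\<close> and \<open>z\<close> both
      become \<open>F\<close> after substituting \<open>F\<close>, which is injective.\<close>
    have "nc_subst (F $ i) G = nc_var i" for i
    proof (rule nc_subst_inject[OF F0 FX])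
      show "nc_subst (nc_subst (F $ i) G) F = nc_subst (nc_var i) F"
        by (simp add: nc_subst_subst[OF F0 G0] vGF nc_subst_var[OF F0])
    qed
    with vGF show "nc_inverse_map G F"
      by (simp add: nc_inverse_map_def nc_vec_subst_def nc_vars_def)
  qed
  \<comment> \<open>The chain rule with \<open>u = N\<close>: its value at \<open>z_i\<close> is
    \<open>N_i(F) + dF_i/dt = W_i - H_i\<close>.\<close>
  have chain: "nc_dvd c (nc_dt (W i) - nc_subst (nc_dt (N $ i)) F + nc_subst (nc_deriv N (N $ i)) F)"
    if "\<And>i. nc_dvd c (W i - h i)" for c i
    unfolding W_def using that by (intro nc_dvd_chain_rule[OF F0]) (simp add: dF W_def)
  \<comment> \<open>\<open>F\<close> is the identity modulo \<open>t\<close>, so \<open>W\<close>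
    and \<open>N\<close> have the same initial value.\<close>
  have W0: "fps_nth (nc_nth (W i) w) 0 = fps_nth (nc_nth (N $ i) w) 0" for i w
    using nc_dvd_subst_diff[OF F0 FX, of "N $ i"] fps_X_power_dvd_iff[of 1 "_ :: 'k fps"]
    by (auto simp: nc_dvd_def W_def)
  have dh: "nc_dt (h i) = 0" for i by (rule nc_eqI) (simp add: h)
  have "(\<forall>i. W i = h i) \<longleftrightarrow> cauchy_solution H N"
  proof
    assume W: "\<forall>i. W i = h i"
    have "nc_dt (N $ i) = nc_deriv N (N $ i)" for i
    proof (rule nc_subst_inject[OF F0 FX])
      \<comment> \<open>Here \<open>W = H\<close>, so \<open>c = 0\<close> is admissible and the
        chain rule becomes an equality, in which \<open>dW/dt = 0\<close>.\<close>
      have "nc_dvd 0 (nc_dt (W i) - nc_subst (nc_dt (N $ i)) F + nc_subst (nc_deriv N (N $ i)) F)"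
        by (rule chain) (simp add: W nc_dvd_def)
      thus "nc_subst (nc_dt (N $ i)) F = nc_subst (nc_deriv N (N $ i)) F"
        by (intro nc_eqI) (simp add: W dh nc_dvd_def)
    qed
    with W show "cauchy_solution H N"
      by (simp add: cauchy_solution_iff h flip: W0)
  next
    assume sol: "cauchy_solution H N"
    have "(\<chi> i. W i - h i) $ i = 0" for i
    proof (rule nc_vec_eq_0_if_dt_dvd)
      fix m i
      assume "\<And>j. nc_dvd (fps_X ^ m) ((\<chi> i. W i - h i) $ j)"
      \<comment> \<open>The differential equation for \<open>N\<close> cancels the two substituted
        terms, leaving \<open>dW/dt\<close>, which is the derivative of
        \<open>W - H\<close>.\<close>
      from chain[of "fps_X ^ m" i] this sol
      show "nc_dvd (fps_X ^ m) (nc_dt ((\<chi> i. W i - h i) $ i))"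
        by (simp add: cauchy_solution_iff nc_dt_diff dh)
    qed (use sol in \<open>simp add: cauchy_solution_iff W0 h\<close>)
    thus "\<forall>i. W i = h i" by simp
  qed
  thus ?thesis
    using inverse_iff cauchy_solution_unique unfolding F_def G_def by blast
qed

end
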